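(* Let $\mathcal{H}$ be a separable complex Hilbert space, let $F=\{f_k\}_{k=1}^\infty$ be a frame for $\mathcal{H}$ with frame operator $S_F$, and let $\{g_k\}_{k=1}^\infty$ be a sequence in $\mathcal{H}$. Then the following statements are equivalent. (i) $\{g_k\}_{k=1}^\infty$ is a Bessel sequence in $\mathcal{H}$ and the pair $(\{f_k\}_{k=1}^\infty,\{g_k\}_{k=1}^\infty)$ is a biframe for $\mathcal{H}$. (ii) There exist $Q\in B^{+}_{b.b.}(\mathcal{H})$ and a Bessel sequence $\{h_k\}_{k=1}^\infty$ in $\mathcal{H}$ such that, for all $k\in\mathbb{N}$, $g_k=(S_FQ)^{-1}f_k+h_k-\sum_{j=1}^\infty\langle S_F^{-1}f_k,f_j\rangle h_j$. (iii) $\{g_k\}_{k=1}^\infty$ is a frame for $\mathcal{H}$ and the pair $(\{f_k\}_{k=1}^\infty,\{g_k\}_{k=1}^\infty)$ is a biframe for $\mathcal{H}$.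
   Context: A pair $(\{f_k\}_{k=1}^\infty,\{g_k\}_{k=1}^\infty)$ of sequences in $\mathcal{H}$ is a biframe for $\mathcal{H}$ if there exist constants $A,B>0$ such that $A\|f\|^2\le\sum_{k=1}^\infty\langle f,f_k\rangle\langle g_k,f\rangle\le B\|f\|^2$ for all $f\in\mathcal{H}$. A sequence $\{f_k\}$ is a frame for $\mathcal{H}$ if there are $A,B>0$ with $A\|f\|^2\le\sum_k|\langle f,f_k\rangle|^2\le B\|f\|^2$ for all $f$, and a Bessel sequence if only the upper inequality is required; the frame operator is $S_Ff=\sum_k\langle f,f_k\rangle f_k$. $B^{+}_{b.b.}(\mathcal{H})$ is the set of bounded, self-adjoint, positive operators on $\mathcal{H}$ that are bounded below ($\exists\alpha>0$: $\alpha\|f\|\le\|Qf\|$ for all $f$). The inner product is linear in the first variable. *)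

theory Defs
  imports "HOL-Analysis.Analysis"
begin

class complex_vector = real_vector +
  fixes scaleC :: "complex \<Rightarrow> 'a \<Rightarrow> 'a"  (infixr "*\<^sub>C" 75)
  assumes scaleC_add_right: "c *\<^sub>C (x + y) = c *\<^sub>C x + c *\<^sub>C y"
    and scaleC_add_left: "(c + d) *\<^sub>C x = c *\<^sub>C x + d *\<^sub>C x"
    and scaleC_scaleC: "c *\<^sub>C (d *\<^sub>C x) = (c * d) *\<^sub>C x"
    and scaleC_one: "1 *\<^sub>C x = x"
    and scaleR_scaleC: "r *\<^sub>R x = complex_of_real r *\<^sub>C x"

text \<open>The inner product is linear in the first and conjugate-linear in the second variable.\<close>

class complex_inner = complex_vector + real_normed_vector +
  fixes cinner :: "'a \<Rightarrow> 'a \<Rightarrow> complex"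
  assumes cinner_commute: "cinner x y = cnj (cinner y x)"
    and cinner_add_left: "cinner (x + y) z = cinner x z + cinner y z"
    and cinner_scaleC_left: "cinner (c *\<^sub>C x) y = c * cinner x y"
    and cinner_self_nonneg: "cinner x x \<in> \<real>\<^sub>\<ge>\<^sub>0"
    and cinner_eq_zero_iff: "cinner x x = 0 \<longleftrightarrow> x = 0"
    and norm_eq_sqrt_cinner: "norm x = sqrt (Re (cinner x x))"

class chilbert_space = complex_inner + complete_space

instantiation complex :: chilbert_space
begin

definition scaleC_complex :: "complex \<Rightarrow> complex \<Rightarrow> complex"
  where "scaleC_complex c x = c * x"

definition cinner_complex :: "complex \<Rightarrow> complex \<Rightarrow> complex"
  where "cinner_complex x y = x * cnj y"

instance
proof
  fix x :: complex
  show "cinner x x \<in> \<real>\<^sub>\<ge>\<^sub>0"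
    by (simp add: cinner_complex_def complex_nonneg_Reals_iff)
  show "norm x = sqrt (Re (cinner x x))"
    by (simp add: cinner_complex_def cmod_def power2_eq_square)
qed (simp_all add: scaleC_complex_def cinner_complex_def scaleR_conv_of_real algebra_simps)

end

definition bounded_clinear :: "('a::complex_inner \<Rightarrow> 'b::complex_inner) \<Rightarrow> bool"
  where "bounded_clinear T \<longleftrightarrow> bounded_linear T \<and> (\<forall>c x. T (c *\<^sub>C x) = c *\<^sub>C T x)"

definition self_adjoint :: "('a::complex_inner \<Rightarrow> 'a) \<Rightarrow> bool"
  where "self_adjoint T \<longleftrightarrow> (\<forall>x y. cinner (T x) y = cinner x (T y))"

definition positive_operator :: "('a::complex_inner \<Rightarrow> 'a) \<Rightarrow> bool"
  where "positive_operator T \<longleftrightarrow> (\<forall>x. cinner (T x) x \<in> \<real>\<^sub>\<ge>\<^sub>0)"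

definition bounded_below :: "('a::complex_inner \<Rightarrow> 'b::complex_inner) \<Rightarrow> bool"
  where "bounded_below T \<longleftrightarrow> (\<exists>\<alpha>>0. \<forall>x. \<alpha> * norm x \<le> norm (T x))"

definition pos_bounded_below_operators :: "('a::chilbert_space \<Rightarrow> 'a) set"
  where "pos_bounded_below_operators =
    {Q. bounded_clinear Q \<and> self_adjoint Q \<and> positive_operator Q \<and> bounded_below Q}"

text \<open>Sequences \<open>(f\<^sub>k)\<close>, \<open>k \<ge> 1\<close>, are reindexed from \<open>0\<close>. Convergence of each series is part of
  the definitions of Bessel sequence, frame and biframe.\<close>

definition bessel_sequence :: "(nat \<Rightarrow> 'a::chilbert_space) \<Rightarrow> bool"
  where "bessel_sequence f \<longleftrightarrow>
    (\<exists>B>0. \<forall>x. summable (\<lambda>k. (cmod (cinner x (f k)))\<^sup>2) \<and>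
      (\<Sum>k. (cmod (cinner x (f k)))\<^sup>2) \<le> B * (norm x)\<^sup>2)"

definition is_frame :: "(nat \<Rightarrow> 'a::chilbert_space) \<Rightarrow> bool"
  where "is_frame f \<longleftrightarrow>
    (\<exists>A>0. \<exists>B>0. \<forall>x. summable (\<lambda>k. (cmod (cinner x (f k)))\<^sup>2) \<and>
      A * (norm x)\<^sup>2 \<le> (\<Sum>k. (cmod (cinner x (f k)))\<^sup>2) \<and>
      (\<Sum>k. (cmod (cinner x (f k)))\<^sup>2) \<le> B * (norm x)\<^sup>2)"

text \<open>The terms of the biframe series are complex; the two-sided inequality says in particular that
  the sum \<open>s\<close> is real.\<close>

definition is_biframe :: "(nat \<Rightarrow> 'a::chilbert_space) \<Rightarrow> (nat \<Rightarrow> 'a) \<Rightarrow> bool"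
  where "is_biframe f g \<longleftrightarrow>
    (\<exists>A>0. \<exists>B>0. \<forall>x. \<exists>s::real.
      (\<lambda>k. cinner x (f k) * cinner (g k) x) sums complex_of_real s \<and>
      A * (norm x)\<^sup>2 \<le> s \<and> s \<le> B * (norm x)\<^sup>2)"

text \<open>The value is meaningful only for convergent series; the series converges in norm whenever \<open>f\<close> is a Bessel sequence.\<close>

definition frame_operator :: "(nat \<Rightarrow> 'a::chilbert_space) \<Rightarrow> 'a \<Rightarrow> 'a"
  where "frame_operator f x = (\<Sum>k. cinner x (f k) *\<^sub>C f k)"

end

theory Submission
  imports Defs
begin

text \<open>For Bessel sequences \<open>f\<close> and \<open>g\<close> put \<open>S x = \<Sum>k. \<langle>x, f\<^sub>k\<rangle> g\<^sub>k\<close>. The pair is a biframe exactly when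
  \<open>S\<close> is a positive operator that is bounded below. If \<open>g\<close> has the form in (ii), then \<open>S = Q\<inverse>\<close>, as the
  terms that involve \<open>h\<close> cancel in the series for \<open>S\<close>; conversely one takes \<open>Q = S\<inverse>\<close> and \<open>h = g\<close>.
  The lower frame bound for \<open>g\<close> is Cauchy--Schwarz applied to the biframe series.\<close>

text \<open>Makes the Cauchy criterion \<open>summable_Cauchy\<close> available for series of
  vectors.\<close>

instance chilbert_space \<subseteq> banach ..

section \<open>Complex inner products\<close>

lemma cinner_add_right: "cinner x (y + z) = cinner x y + cinner x (z::'a::complex_inner)"
  by (metis cinner_commute cinner_add_left complex_cnj_add)

lemma cinner_scaleC_right: "cinner x (c *\<^sub>C y) = cnj c * cinner x (y::'a::complex_inner)"
  by (metis cinner_commute cinner_scaleC_left complex_cnj_mult)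

lemma cinner_scaleR_left: "cinner (r *\<^sub>R x) (y::'a::complex_inner) = r *\<^sub>R cinner x y"
  by (simp add: scaleR_scaleC scaleC_complex_def cinner_scaleC_left)

lemma cinner_scaleR_right: "cinner x (r *\<^sub>R (y::'a::complex_inner)) = r *\<^sub>R cinner x y"
  by (simp add: scaleR_scaleC scaleC_complex_def cinner_scaleC_right)

lemma cinner_diff_left: "cinner (x - y) z = cinner x z - cinner y (z::'a::complex_inner)"
  using cinner_add_left[of "x - y" y z] by simp

lemma cinner_diff_right: "cinner x (y - z) = cinner x y - cinner x (z::'a::complex_inner)"
  using cinner_add_right[of x "y - z" z] by simp

lemma cinner_self: "cinner x x = complex_of_real ((norm (x::'a::complex_inner))\<^sup>2)"
  using cinner_self_nonneg[of x]
  by (auto simp: norm_eq_sqrt_cinner complex_nonneg_Reals_iff complex_eq_iff)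

lemma cmod_cinner_commute: "cmod (cinner x (y::'a::complex_inner)) = cmod (cinner y x)"
  by (metis cinner_commute complex_mod_cnj)

text \<open>The form \<open>cinner (T x) y\<close> is a semi-inner product, so the classical
  discriminant argument applies. The identity gives the usual Cauchy--Schwarz inequality; the case
  \<open>y = T x\<close> later turns a lower bound for the norm into coercivity.\<close>

lemma positive_Cauchy_Schwarz:
  fixes T :: "'a::complex_inner \<Rightarrow> 'a"
  assumes T: "bounded_clinear T" and sa: "self_adjoint T" and pos: "positive_operator T"
  shows "(cmod (cinner (T x) y))\<^sup>2 \<le> Re (cinner (T x) x) * Re (cinner (T y) y)"
proof -
  interpret bounded_linear T using T by (simp add: bounded_clinear_def)
  define a where "a = cinner (T x) y"
  define p where "p = Re (cinner (T x) x)"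
  define q where "q = Re (cinner (T y) y)"
  have p0: "p \<ge> 0" and q0: "q \<ge> 0"
    using pos by (auto simp: positive_operator_def complex_nonneg_Reals_iff p_def q_def)
  have a': "cinner (T y) x = cnj a"
    using sa cinner_commute[of "T y" x] by (simp add: self_adjoint_def a_def)
  \<comment> \<open>This is the form at \<open>x - c y\<close> with \<open>c = t a\<close>. The
    factor \<open>a\<close> aligns the phases, so that both cross terms become the real number
    \<open>t * (cmod a)\<^sup>2\<close>.\<close>
  have quad: "0 \<le> p - 2 * t * (cmod a)\<^sup>2 + t\<^sup>2 * (cmod a)\<^sup>2 * q" for t :: real
  proof -
    define c where "c = complex_of_real t * a"
    have "T (x - c *\<^sub>C y) = T x - c *\<^sub>C T y"
      using T by (simp add: diff bounded_clinear_def)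
    then have "cinner (T (x - c *\<^sub>C y)) (x - c *\<^sub>C y)
        = cinner (T x) x - cnj c * a - c * cnj a + c * cnj c * cinner (T y) y"
      by (simp add: cinner_diff_left cinner_diff_right cinner_scaleC_left cinner_scaleC_right a'
          a_def[symmetric] right_diff_distrib mult_ac)
    moreover have "cnj c * a = of_real (t * (cmod a)\<^sup>2)" "c * cnj a = of_real (t * (cmod a)\<^sup>2)"
      "c * cnj c = of_real (t\<^sup>2 * (cmod a)\<^sup>2)"
      using complex_norm_square[of a] by (simp_all add: c_def power2_eq_square algebra_simps)
    ultimately have "Re (cinner (T (x - c *\<^sub>C y)) (x - c *\<^sub>C y))
        = p - 2 * t * (cmod a)\<^sup>2 + t\<^sup>2 * (cmod a)\<^sup>2 * q"
      by (simp add: p_def q_def del: of_real_mult of_real_power)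
    then show ?thesis
      using pos by (metis positive_operator_def complex_nonneg_Reals_iff)
  qed
  have "(cmod a)\<^sup>2 \<le> p * q"
  proof (cases "q = 0")
    case True
    have "a = 0"
    proof (rule ccontr)
      assume "a \<noteq> 0"
      then show False
        \<comment> \<open>For \<open>q = 0\<close> the bound is affine in t; this t makes its
          right-hand side -p - 2, which is negative.\<close>
        using quad[of "(p + 1) / (cmod a)\<^sup>2"] True p0 \<open>a \<noteq> 0\<close> by simp
    qed
    then show ?thesis using True by simp
  next
    case False
    then show ?thesis
      \<comment> \<open>The minimum over t is attained at 1/q.\<close>
      using quad[of "1 / q"] q0 by (simp add: field_simps power2_eq_square)
  qed
  then show ?thesis by (simp add: a_def p_def q_def)
qed

lemma Cauchy_Schwarz_cinner: "cmod (cinner x y) \<le> norm x * norm (y::'a::complex_inner)"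
proof -
  have "(cmod (cinner x y))\<^sup>2 \<le> Re (cinner x x) * Re (cinner y y)"
    using positive_Cauchy_Schwarz[of "\<lambda>x. x" x y]
    by (simp add: bounded_clinear_def bounded_linear_ident self_adjoint_def positive_operator_def
        cinner_self_nonneg)
  then have "(cmod (cinner x y))\<^sup>2 \<le> (norm x * norm y)\<^sup>2"
    by (simp add: cinner_self power_mult_distrib)
  then show ?thesis
    by (rule power2_le_imp_le) simp
qed

lemma bounded_bilinear_cinner:
  "bounded_bilinear (cinner :: 'a::complex_inner \<Rightarrow> 'a \<Rightarrow> complex)"
proof
  show "\<exists>K. \<forall>a b::'a. norm (cinner a b) \<le> norm a * norm b * K"
    using Cauchy_Schwarz_cinner by (intro exI[of _ 1]) auto
qed (simp_all add: cinner_add_left cinner_add_right cinner_scaleR_left cinner_scaleR_right)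

lemmas bounded_linear_cinner_left = bounded_bilinear.bounded_linear_left[OF bounded_bilinear_cinner]
lemmas bounded_linear_cinner_right = bounded_bilinear.bounded_linear_right[OF bounded_bilinear_cinner]
lemmas cinner_sum_left = bounded_bilinear.sum_left[OF bounded_bilinear_cinner]

lemma norm_scaleC: "norm (c *\<^sub>C (x::'a::complex_inner)) = cmod c * norm x"
proof -
  have "complex_of_real ((norm (c *\<^sub>C x))\<^sup>2) = complex_of_real ((cmod c * norm x)\<^sup>2)"
    using complex_norm_square[of c]
    by (simp add: cinner_self[symmetric] cinner_scaleC_left cinner_scaleC_right power_mult_distrib
        mult_ac flip: of_real_power)
  then have "(norm (c *\<^sub>C x))\<^sup>2 = (cmod c * norm x)\<^sup>2"
    by (simp only: of_real_eq_iff)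
  then show ?thesis by (simp add: power2_eq_iff_nonneg)
qed

lemma bounded_linear_scaleC: "bounded_linear (\<lambda>x::'a::complex_inner. c *\<^sub>C x)"
proof (rule bounded_linear_intro[where K = "cmod c"])
  show "c *\<^sub>C r *\<^sub>R x = r *\<^sub>R c *\<^sub>C x" for r and x :: 'a
    by (simp add: scaleR_scaleC scaleC_scaleC mult.commute)
qed (simp_all add: scaleC_add_right norm_scaleC mult.commute)

lemma cinner_extI:
  assumes "\<And>z. cinner x z = cinner y (z::'a::complex_inner)"
  shows "x = y"
  using assms[of "x - y"] by (metis cinner_diff_left cinner_eq_zero_iff right_minus_eq)

section \<open>Coercive operators\<close>

text \<open>Polarization: reality of the form at \<open>x + y\<close> matches the imaginary parts of
  the mixed terms, and at \<open>x + \<i> *\<^sub>C y\<close> the real parts.\<close>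

lemma self_adjoint_if_real_form:
  fixes T :: "'a::complex_inner \<Rightarrow> 'a"
  assumes T: "bounded_clinear T" and real: "\<And>x. Im (cinner (T x) x) = 0"
  shows "self_adjoint T"
  unfolding self_adjoint_def
proof (intro allI)
  fix x y
  interpret bounded_linear T using T by (simp add: bounded_clinear_def)
  have TC: "T (c *\<^sub>C z) = c *\<^sub>C T z" for c z using T by (simp add: bounded_clinear_def)
  have "Im (cinner (T x) y) + Im (cinner (T y) x) = 0"
    using real[of "x + y"] real[of x] real[of y] by (simp add: add cinner_add_left cinner_add_right)
  moreover have "Re (cinner (T y) x) = Re (cinner (T x) y)"
    using real[of "x + \<i> *\<^sub>C y"] real[of x] real[of y]
    by (simp add: add TC cinner_add_left cinner_add_right cinner_scaleC_left cinner_scaleC_right)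
  ultimately show "cinner (T x) y = cinner x (T y)"
    by (subst cinner_commute[of x]) (simp add: complex_eq_iff)
qed

text \<open>Lax--Milgram: for a small step \<open>t\<close> the map \<open>x \<mapsto> x - t (T x - y)\<close> is a contraction.\<close>

lemma surj_if_coercive:
  fixes T :: "'a::chilbert_space \<Rightarrow> 'a"
  assumes T: "bounded_clinear T" and A: "A > 0" "\<And>x. A * (norm x)\<^sup>2 \<le> Re (cinner (T x) x)"
  shows "surj T"
proof (rule surjI)
  fix y
  interpret bounded_linear T using T by (simp add: bounded_clinear_def)
  obtain K0 where K0: "K0 > 0" "\<And>x. norm (T x) \<le> norm x * K0" using pos_bounded by blast
  \<comment> \<open>Adding A to the norm bound makes K strictly larger than A, so that the
    contraction constant c below is a real number in [0,1).\<close>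
  define K where "K = K0 + A"
  have K: "K > 0" "A < K" using K0 A by (auto simp: K_def)
  have TK: "norm (T x) \<le> norm x * K" for x
  proof -
    have "0 \<le> norm x * A" using A(1) by simp
    then show ?thesis using K0(2)[of x] by (simp add: K_def distrib_left)
  qed
  \<comment> \<open>This t minimizes 1 - 2 t A + t^2 K^2, the bound for the squared contraction
    factor; the minimum is 1 - A^2/K^2.\<close>
  define t where "t = A / K\<^sup>2"
  define c where "c = sqrt (1 - A\<^sup>2 / K\<^sup>2)"
  define \<phi> where "\<phi> x = x - t *\<^sub>R (T x - y)" for x
  have "A\<^sup>2 < K\<^sup>2" using A K by (simp add: power_strict_mono)
  then have c: "0 \<le> c" "c < 1" "c\<^sup>2 = 1 - A\<^sup>2 / K\<^sup>2"
    using A K by (auto simp: c_def)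
  have t0: "t \<ge> 0" using A K by (simp add: t_def)
  have contr: "dist (\<phi> u) (\<phi> v) \<le> c * dist u v" for u v
  proof -
    define z where "z = u - v"
    have \<phi>z: "\<phi> u - \<phi> v = z - t *\<^sub>R T z"
      by (simp add: \<phi>_def z_def diff algebra_simps)
    have sym: "Re (cinner z (T z)) = Re (cinner (T z) z)"
      by (subst cinner_commute) simp
    have "cinner (z - t *\<^sub>R T z) (z - t *\<^sub>R T z) =
       of_real ((norm z)\<^sup>2) - t *\<^sub>R cinner z (T z) - t *\<^sub>R cinner (T z) z
       + (t\<^sup>2) *\<^sub>R of_real ((norm (T z))\<^sup>2)"
      by (simp add: cinner_diff_left cinner_diff_right cinner_scaleR_left cinner_scaleR_right
         cinner_self[of z] cinner_self[of "T z"] power2_eq_square algebra_simps)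
    from arg_cong[OF this, of Re]
    have "(norm (z - t *\<^sub>R T z))\<^sup>2
        = (norm z)\<^sup>2 - 2 * t * Re (cinner (T z) z) + t\<^sup>2 * (norm (T z))\<^sup>2"
      by (simp add: cinner_self sym flip: of_real_power of_real_mult)
    also have "\<dots> \<le> (norm z)\<^sup>2 - 2 * t * (A * (norm z)\<^sup>2) + t\<^sup>2 * (norm z * K)\<^sup>2"
    proof -
      have "2 * t * (A * (norm z)\<^sup>2) \<le> 2 * t * Re (cinner (T z) z)"
        using A(2)[of z] t0 by (intro mult_left_mono) auto
      moreover have "t\<^sup>2 * (norm (T z))\<^sup>2 \<le> t\<^sup>2 * (norm z * K)\<^sup>2"
        using TK[of z] by (intro mult_left_mono power_mono) auto
      ultimately show ?thesis by linarith
    qed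
    also have "\<dots> = (1 - A\<^sup>2 / K\<^sup>2) * (norm z)\<^sup>2"
      using K by (simp add: t_def field_simps power2_eq_square)
    also have "\<dots> = (c * norm z)\<^sup>2" using c by (simp add: power_mult_distrib)
    finally have "norm (z - t *\<^sub>R T z) \<le> c * norm z"
      by (rule power2_le_imp_le) (use c in auto)
    then show ?thesis by (simp add: dist_norm \<phi>z) (simp add: z_def)
  qed
  have "\<exists>!x. x \<in> UNIV \<and> \<phi> x = x"
    by (rule Banach_fix[where c = c]) (use c contr complete_UNIV in auto)
  then obtain x where "\<phi> x = x" by blast
  moreover have "t \<noteq> 0" using A K by (simp add: t_def)
  ultimately have "T x = y" by (simp add: \<phi>_def)
  \<comment> \<open>Choice supplies the right inverse that \<open>surjI\<close> asks for.\<close>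
  then show "T (SOME x. T x = y) = y" by (rule someI)
qed

text \<open>Cauchy--Schwarz turns coercivity into a lower bound for the norm, and polarization turns
  reality of the form into self-adjointness. The hypotheses are what a biframe inequality says about
  its operator.\<close>

lemma pos_bounded_below_operatorsI:
  fixes T :: "'a::chilbert_space \<Rightarrow> 'a"
  assumes T: "bounded_clinear T" and A: "A > 0" "\<And>x. A * (norm x)\<^sup>2 \<le> Re (cinner (T x) x)"
    and real: "\<And>x. Im (cinner (T x) x) = 0"
  shows "T \<in> pos_bounded_below_operators"
proof -
  have "positive_operator T"
    unfolding positive_operator_def complex_nonneg_Reals_iff
    using A real by (meson less_imp_le mult_nonneg_nonneg order_trans zero_le_power2)
  moreover have "bounded_below T"
    unfolding bounded_below_def
  proof (intro exI conjI allI)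
    fix x
    have "A * (norm x)\<^sup>2 \<le> norm (T x) * norm x"
      using A(2)[of x] complex_Re_le_cmod[of "cinner (T x) x"] Cauchy_Schwarz_cinner[of "T x" x]
      by linarith
    then show "A * norm x \<le> norm (T x)"
      by (cases "x = 0") (simp_all add: power2_eq_square)
  qed (rule A)
  ultimately show ?thesis
    using self_adjoint_if_real_form T real by (auto simp: pos_bounded_below_operators_def)
qed

text \<open>Cauchy--Schwarz for the form \<open>\<langle>T x, y\<rangle>\<close> with \<open>y = T x\<close> gives \<open>\<parallel>T x\<parallel>\<^sup>2 \<le> K \<langle>T x, x\<rangle>\<close>.\<close>

lemma pos_bounded_below_coercive:
  fixes T :: "'a::chilbert_space \<Rightarrow> 'a"
  assumes "T \<in> pos_bounded_below_operators"
  obtains A where "A > 0" "\<And>x. A * (norm x)\<^sup>2 \<le> Re (cinner (T x) x)"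
proof -
  have T: "bounded_clinear T" "self_adjoint T" "positive_operator T" "bounded_below T"
    using assms by (auto simp: pos_bounded_below_operators_def)
  interpret bounded_linear T using T by (simp add: bounded_clinear_def)
  obtain K where K: "K > 0" "\<And>x. norm (T x) \<le> norm x * K" using pos_bounded by blast
  obtain \<alpha> where \<alpha>: "\<alpha> > 0" "\<And>x. \<alpha> * norm x \<le> norm (T x)"
    using T(4) by (auto simp: bounded_below_def)
  \<comment> \<open>Combine \<open>\<alpha> * norm x \<le> norm (T x)\<close> with the bound of
    \<open>(norm (T x))\<^sup>2\<close> by K times the form. The latter comes from cancelling a
    factor \<open>(norm (T x))\<^sup>2\<close>; if \<open>T x = 0\<close>, the lower bound forces
    \<open>x = 0\<close>.\<close>
  have "\<alpha>\<^sup>2 / K * (norm x)\<^sup>2 \<le> Re (cinner (T x) x)" for x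
  proof (cases "T x = 0")
    case True
    then show ?thesis using \<alpha>(1) \<alpha>(2)[of x] by (simp add: mult_le_0_iff cinner_self)
  next
    case False
    define p where "p = Re (cinner (T x) x)"
    have p0: "p \<ge> 0" using T(3) by (simp add: p_def positive_operator_def complex_nonneg_Reals_iff)
    have "((norm (T x))\<^sup>2)\<^sup>2 \<le> p * Re (cinner (T (T x)) (T x))"
      using positive_Cauchy_Schwarz[OF T(1-3), of x "T x"]
      by (simp add: cinner_self p_def norm_power)
    also have "\<dots> \<le> p * ((norm (T x))\<^sup>2 * K)"
    proof (rule mult_left_mono[OF _ p0])
      have "Re (cinner (T (T x)) (T x)) \<le> norm (T (T x)) * norm (T x)"
        using complex_Re_le_cmod Cauchy_Schwarz_cinner order_trans by blast
      also have "\<dots> \<le> norm (T x) * K * norm (T x)"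
        using K by (intro mult_right_mono) auto
      finally show "Re (cinner (T (T x)) (T x)) \<le> (norm (T x))\<^sup>2 * K"
        by (simp add: power2_eq_square mult_ac)
    qed
    finally have "(norm (T x))\<^sup>2 * (norm (T x))\<^sup>2 \<le> (p * K) * (norm (T x))\<^sup>2"
      by (simp add: power2_eq_square mult_ac)
    then have "(norm (T x))\<^sup>2 \<le> p * K"
      by (rule mult_right_le_imp_le) (use False in simp)
    moreover have "(\<alpha> * norm x)\<^sup>2 \<le> (norm (T x))\<^sup>2"
      using \<alpha> by (intro power_mono) auto
    ultimately show ?thesis
      using K by (simp add: p_def[symmetric] field_simps)
  qed
  with that[of "\<alpha>\<^sup>2 / K"] \<alpha> K show thesis by simp
qed

text \<open>Coercivity yields surjectivity and the lower norm bound injectivity. Hence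
  \<open>inv T\<close> is a genuine two-sided inverse and not just a choice function.\<close>

lemma bij_if_pos_bounded_below:
  fixes T :: "'a::chilbert_space \<Rightarrow> 'a"
  assumes "T \<in> pos_bounded_below_operators"
  shows "bij T"
proof (rule bijI)
  have T: "bounded_clinear T" "bounded_below T"
    using assms by (auto simp: pos_bounded_below_operators_def)
  interpret bounded_linear T using T by (simp add: bounded_clinear_def)
  show "surj T"
    using assms T(1) by (meson pos_bounded_below_coercive surj_if_coercive)
  show "inj T"
  proof (rule injI)
    fix x y assume "T x = T y"
    moreover obtain \<alpha> where "\<alpha> > 0" "\<And>x. \<alpha> * norm x \<le> norm (T x)"
      using T(2) by (auto simp: bounded_below_def)
    ultimately show "x = y"
      by (metis diff eq_iff_diff_eq_0 mult_le_0_iff norm_le_zero_iff norm_zero not_le)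
  qed
qed

text \<open>The two norm bounds exchange roles: the lower bound \<alpha> of T gives the upper bound
  1/\<alpha> of the inverse, and the upper bound K gives the lower bound 1/K. Symmetry and
  positivity follow by writing each vector as \<open>T (inv T x)\<close>.\<close>

lemma inv_pos_bounded_below:
  fixes T :: "'a::chilbert_space \<Rightarrow> 'a"
  assumes "T \<in> pos_bounded_below_operators"
  shows "inv T \<in> pos_bounded_below_operators"
proof -
  have T: "bounded_clinear T" "self_adjoint T" "positive_operator T" "bounded_below T"
    using assms by (auto simp: pos_bounded_below_operators_def)
  have TC: "T (c *\<^sub>C z) = c *\<^sub>C T z" for c z using T by (simp add: bounded_clinear_def)
  interpret bounded_linear T using T by (simp add: bounded_clinear_def)
  have bij: "bij T" using assms by (rule bij_if_pos_bounded_below)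
  have Ti: "T (inv T x) = x" for x using bij by (simp add: bij_is_surj surj_f_inv_f)
  have invI: "inv T x = y" if "T y = x" for x y
    using bij that by (metis bij_is_inj inv_f_f)
  obtain K where K: "K > 0" "\<And>x. norm (T x) \<le> norm x * K" using pos_bounded by blast
  obtain \<alpha> where \<alpha>: "\<alpha> > 0" "\<And>x. \<alpha> * norm x \<le> norm (T x)"
    using T(4) by (auto simp: bounded_below_def)
  have "bounded_linear (inv T)"
  proof (rule bounded_linear_intro[where K = "1 / \<alpha>"])
    show "norm (inv T x) \<le> norm x * (1 / \<alpha>)" for x
      using \<alpha>(1) \<alpha>(2)[of "inv T x"] by (simp add: Ti field_simps)
  qed (auto intro!: invI simp: add scaleR Ti)
  moreover have "inv T (c *\<^sub>C x) = c *\<^sub>C inv T x" for c x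
    by (intro invI) (simp add: TC Ti)
  moreover have "cinner (inv T x) y = cinner x (inv T y)" for x y
    using T(2) by (metis Ti self_adjoint_def)
  moreover have "cinner (inv T x) x \<in> \<real>\<^sub>\<ge>\<^sub>0" for x
    using T(2,3) by (metis Ti self_adjoint_def positive_operator_def)
  moreover have "1 / K * norm x \<le> norm (inv T x)" for x
    using K(1) K(2)[of "inv T x"] by (simp add: Ti field_simps)
  ultimately show ?thesis
    using K(1)
    by (auto simp: pos_bounded_below_operators_def bounded_clinear_def self_adjoint_def
        positive_operator_def bounded_below_def intro!: exI[of _ "1 / K"])
qed

section \<open>Bessel sequences\<close>

text \<open>Boundedness of the synthesis map by duality: pair the sum v with itself, apply
  Cauchy--Schwarz to the coefficients, use the Bessel bound at v, and cancel
  \<open>(norm v)\<^sup>2\<close>.\<close>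

lemma norm_sum_scaleC_le:
  fixes h :: "nat \<Rightarrow> 'a::chilbert_space"
  assumes B0: "B \<ge> 0" and B: "\<And>x. summable (\<lambda>k. (cmod (cinner x (h k)))\<^sup>2)"
      "\<And>x. (\<Sum>k. (cmod (cinner x (h k)))\<^sup>2) \<le> B * (norm x)\<^sup>2"
    and I: "finite I"
  shows "(norm (\<Sum>k\<in>I. c k *\<^sub>C h k))\<^sup>2 \<le> B * (\<Sum>k\<in>I. (cmod (c k))\<^sup>2)"
proof -
  define v where "v = (\<Sum>k\<in>I. c k *\<^sub>C h k)"
  have "(norm v)\<^sup>2 = cmod (cinner v v)" by (simp add: cinner_self norm_power)
  also have "cinner v v = (\<Sum>k\<in>I. c k * cinner (h k) v)"
    by (subst (1) v_def) (simp add: cinner_sum_left cinner_scaleC_left)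
  also have "cmod \<dots> \<le> (\<Sum>k\<in>I. cmod (c k) * cmod (cinner v (h k)))"
    by (rule order_trans[OF norm_sum]) (simp add: norm_mult cmod_cinner_commute)
  finally have "((norm v)\<^sup>2)\<^sup>2 \<le> (\<Sum>k\<in>I. cmod (c k) * cmod (cinner v (h k)))\<^sup>2"
    by (intro power_mono) auto
  also have "\<dots> \<le> (\<Sum>k\<in>I. (cmod (c k))\<^sup>2) * (\<Sum>k\<in>I. (cmod (cinner v (h k)))\<^sup>2)"
    by (rule Cauchy_Schwarz_ineq_sum)
  also have "\<dots> \<le> (\<Sum>k\<in>I. (cmod (c k))\<^sup>2) * (B * (norm v)\<^sup>2)"
    using B(2)[of v] sum_le_suminf[OF B(1)[of v] I] by (intro mult_left_mono sum_nonneg) auto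
  finally have *: "(norm v)\<^sup>2 * (norm v)\<^sup>2 \<le> (B * (\<Sum>k\<in>I. (cmod (c k))\<^sup>2)) * (norm v)\<^sup>2"
    by (simp add: power2_eq_square mult_ac)
  show ?thesis
    unfolding v_def[symmetric]
  proof (cases "v = 0")
    case True
    then show "(norm v)\<^sup>2 \<le> B * (\<Sum>k\<in>I. (cmod (c k))\<^sup>2)"
      using B0 by (simp add: sum_nonneg)
  next
    case False
    then show "(norm v)\<^sup>2 \<le> B * (\<Sum>k\<in>I. (cmod (c k))\<^sup>2)"
      using mult_right_le_imp_le[OF *] by simp
  qed
qed

lemma summable_scaleC_if_square_summable:
  fixes h :: "nat \<Rightarrow> 'a::chilbert_space"
  assumes h: "bessel_sequence h" and c: "summable (\<lambda>k. (cmod (c k))\<^sup>2)"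
  shows "summable (\<lambda>k. c k *\<^sub>C h k)"
proof -
  obtain B where B: "B > 0" "\<And>x. summable (\<lambda>k. (cmod (cinner x (h k)))\<^sup>2)"
      "\<And>x. (\<Sum>k. (cmod (cinner x (h k)))\<^sup>2) \<le> B * (norm x)\<^sup>2"
    using h by (auto simp: bessel_sequence_def)
  show ?thesis
    unfolding summable_Cauchy
  proof (intro allI impI)
    fix e :: real assume e: "e > 0"
    \<comment> \<open>By the finite estimate, a block of the scalar series below e^2/B keeps the
      corresponding vector block below e in norm.\<close>
    then have "e\<^sup>2 / B > 0" using B(1) by simp
    with c obtain N where N: "\<And>m n. m \<ge> N \<Longrightarrow> norm (\<Sum>k=m..<n. (cmod (c k))\<^sup>2) < e\<^sup>2 / B"
      unfolding summable_Cauchy by meson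
    have "norm (\<Sum>k=m..<n. c k *\<^sub>C h k) < e" if "m \<ge> N" for m n
    proof -
      have "(norm (\<Sum>k=m..<n. c k *\<^sub>C h k))\<^sup>2 \<le> B * (\<Sum>k=m..<n. (cmod (c k))\<^sup>2)"
        by (rule norm_sum_scaleC_le) (use B in auto)
      also have "\<dots> < e\<^sup>2"
        using N[OF that, of n] B(1) by (simp add: field_simps abs_of_nonneg sum_nonneg)
      finally show ?thesis using e by (simp add: power_less_imp_less_base)
    qed
    then show "\<exists>N. \<forall>m\<ge>N. \<forall>n. norm (\<Sum>k=m..<n. c k *\<^sub>C h k) < e" by blast
  qed
qed

section \<open>Mixed frame operators: analysis with \<open>f\<close>, then synthesis with
  \<open>g\<close>\<close>

definition mixed_frame_operator ::
    "(nat \<Rightarrow> 'a::chilbert_space) \<Rightarrow> (nat \<Rightarrow> 'a) \<Rightarrow> 'a \<Rightarrow> 'a"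
  where "mixed_frame_operator f g x = (\<Sum>k. cinner x (f k) *\<^sub>C g k)"

lemma frame_operator_eq_mixed: "frame_operator f = mixed_frame_operator f f"
  by (simp add: frame_operator_def mixed_frame_operator_def fun_eq_iff)

text \<open>The Bessel property of \<open>f\<close> makes the coefficients square-summable, and that
  of \<open>g\<close> then makes the vector series converge. So the \<open>suminf\<close> in the
  definition is a true limit here.\<close>

lemma mixed_frame_operator_sums:
  assumes "bessel_sequence f" "bessel_sequence g"
  shows "(\<lambda>k. cinner x (f k) *\<^sub>C g k) sums mixed_frame_operator f g x"
proof -
  have "summable (\<lambda>k. (cmod (cinner x (f k)))\<^sup>2)"
    using assms(1) by (auto simp: bessel_sequence_def)
  then show ?thesis
    unfolding mixed_frame_operator_def
    by (intro summable_sums summable_scaleC_if_square_summable assms)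
qed

lemma mixed_frame_operator_cinner_sums:
  assumes "bessel_sequence f" "bessel_sequence g"
  shows "(\<lambda>k. cinner x (f k) * cinner (g k) y) sums cinner (mixed_frame_operator f g x) y"
  using bounded_linear.sums[OF bounded_linear_cinner_left mixed_frame_operator_sums[OF assms], of x y]
  by (simp add: cinner_scaleC_left)

text \<open>Both sides are the sum of the same scalar series, by continuity of the inner product in
  each argument. Taking adjoints thus swaps the two sequences.\<close>

lemma mixed_frame_operator_adjoint:
  assumes "bessel_sequence f" "bessel_sequence g"
  shows "cinner (mixed_frame_operator f g x) y = cinner x (mixed_frame_operator g f y)"
proof -
  have "(\<lambda>k. cinner x (f k) * cinner (g k) y) sums cinner x (mixed_frame_operator g f y)"
    using bounded_linear.sums[OF bounded_linear_cinner_right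
        mixed_frame_operator_sums[OF assms(2,1)], of x y]
    by (simp add: cinner_scaleC_right mult.commute flip: cinner_commute)
  with mixed_frame_operator_cinner_sums[OF assms] show ?thesis
    by (rule sums_unique2)
qed

lemma bounded_clinear_mixed_frame_operator:
  assumes "bessel_sequence f" "bessel_sequence g"
  shows "bounded_clinear (mixed_frame_operator f g)"
proof -
  let ?S = "mixed_frame_operator f g"
  obtain B where B: "B > 0" "\<And>x. summable (\<lambda>k. (cmod (cinner x (f k)))\<^sup>2)"
      "\<And>x. (\<Sum>k. (cmod (cinner x (f k)))\<^sup>2) \<le> B * (norm x)\<^sup>2"
    using assms(1) by (auto simp: bessel_sequence_def)
  obtain C where C: "C > 0" "\<And>x. summable (\<lambda>k. (cmod (cinner x (g k)))\<^sup>2)"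
      "\<And>x. (\<Sum>k. (cmod (cinner x (g k)))\<^sup>2) \<le> C * (norm x)\<^sup>2"
    using assms(2) by (auto simp: bessel_sequence_def)
  note adj = mixed_frame_operator_adjoint[OF assms]
  \<comment> \<open>The finite synthesis estimate bounds every partial sum uniformly, and the bound
    passes to the limit.\<close>
  have bound: "norm (?S x) \<le> norm x * sqrt (C * B)" for x
  proof (rule LIMSEQ_le_const2)
    show "(\<lambda>n. norm (\<Sum>k<n. cinner x (f k) *\<^sub>C g k)) \<longlonglongrightarrow> norm (?S x)"
      using mixed_frame_operator_sums[OF assms] by (intro tendsto_norm) (simp add: sums_def)
    have "norm (\<Sum>k<n. cinner x (f k) *\<^sub>C g k) \<le> norm x * sqrt (C * B)" for n
    proof -
      have "(norm (\<Sum>k<n. cinner x (f k) *\<^sub>C g k))\<^sup>2 \<le> C * (\<Sum>k<n. (cmod (cinner x (f k)))\<^sup>2)"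
        by (rule norm_sum_scaleC_le) (use C in auto)
      also have "\<dots> \<le> C * (B * (norm x)\<^sup>2)"
        using C(1) B(3)[of x] sum_le_suminf[OF B(2)[of x], of "{..<n}"]
        by (intro mult_left_mono) auto
      also have "\<dots> = (norm x * sqrt (C * B))\<^sup>2"
        using B(1) C(1) by (simp add: power_mult_distrib)
      finally show ?thesis
        by (rule power2_le_imp_le) (use B C in auto)
    qed
    then show "\<exists>N. \<forall>n\<ge>N. norm (\<Sum>k<n. cinner x (f k) *\<^sub>C g k) \<le> norm x * sqrt (C * B)"
      by blast
  qed
  \<comment> \<open>A map with an adjoint is linear: once \<open>adj\<close> has moved the operator
    to the other argument, only linearity of the inner product is left to use.\<close>
  have "bounded_linear ?S"
  proof (rule bounded_linear_intro[OF _ _ bound])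
    show "?S (x + y) = ?S x + ?S y" for x y
      by (rule cinner_extI) (simp add: adj cinner_add_left)
    show "?S (r *\<^sub>R x) = r *\<^sub>R ?S x" for r x
      by (rule cinner_extI) (simp add: adj cinner_scaleR_left)
  qed
  moreover have "?S (c *\<^sub>C x) = c *\<^sub>C ?S x" for c x
    by (rule cinner_extI) (simp add: adj cinner_scaleC_left)
  ultimately show ?thesis by (simp add: bounded_clinear_def)
qed

text \<open>The biframe series at x sums to \<open>cinner (?S x) x\<close>. By uniqueness of sums
  the real witness s is this value, so the form is real and coercive. Conversely, coercivity and
  boundedness of the operator are the two biframe inequalities.\<close>

lemma is_biframe_iff:
  assumes "bessel_sequence f" "bessel_sequence g"
  shows "is_biframe f g \<longleftrightarrow> mixed_frame_operator f g \<in> pos_bounded_below_operators"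
proof
  let ?S = "mixed_frame_operator f g"
  note S = mixed_frame_operator_cinner_sums[OF assms]
  {
    assume "is_biframe f g"
    then obtain A where A: "A > 0" and "\<forall>x. \<exists>s::real.
        (\<lambda>k. cinner x (f k) * cinner (g k) x) sums complex_of_real s \<and> A * (norm x)\<^sup>2 \<le> s"
      unfolding is_biframe_def by blast
    then have "\<exists>s::real. cinner (?S x) x = complex_of_real s \<and> A * (norm x)\<^sup>2 \<le> s" for x
      using S sums_unique2 by blast
    then have "A * (norm x)\<^sup>2 \<le> Re (cinner (?S x) x)" "Im (cinner (?S x) x) = 0" for x
      by (metis Re_complex_of_real, metis Im_complex_of_real)
    then show "?S \<in> pos_bounded_below_operators"
      using bounded_clinear_mixed_frame_operator[OF assms] A pos_bounded_below_operatorsI by blast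
  next
    assume pbb: "?S \<in> pos_bounded_below_operators"
    then obtain A where A: "A > 0" "\<And>x. A * (norm x)\<^sup>2 \<le> Re (cinner (?S x) x)"
      using pos_bounded_below_coercive by blast
    interpret bounded_linear ?S
      using bounded_clinear_mixed_frame_operator[OF assms] by (simp add: bounded_clinear_def)
    obtain K where K: "K > 0" "\<And>x. norm (?S x) \<le> norm x * K" using pos_bounded by blast
    have "Re (cinner (?S x) x) \<le> K * (norm x)\<^sup>2" for x
    proof -
      have "Re (cinner (?S x) x) \<le> norm (?S x) * norm x"
        using complex_Re_le_cmod Cauchy_Schwarz_cinner order_trans by blast
      also have "\<dots> \<le> norm x * K * norm x"
        using K by (intro mult_right_mono) auto
      finally show ?thesis by (simp add: power2_eq_square mult_ac)
    qed
    moreover have "(\<lambda>k. cinner x (f k) * cinner (g k) x) sums of_real (Re (cinner (?S x) x))" for x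
    proof -
      have "Im (cinner (?S x) x) = 0"
        using pbb by (auto simp: pos_bounded_below_operators_def positive_operator_def
            complex_nonneg_Reals_iff)
      then have "of_real (Re (cinner (?S x) x)) = cinner (?S x) x" by (simp add: complex_eq_iff)
      then show ?thesis using S[of x x] by simp
    qed
    ultimately show "is_biframe f g"
      unfolding is_biframe_def using A K(1) by blast
  }
qed

section \<open>Frames and biframes\<close>

lemma bessel_sequence_if_frame: "is_frame f \<Longrightarrow> bessel_sequence f"
  unfolding is_frame_def bessel_sequence_def by meson

text \<open>For equal sequences the biframe terms are the squared moduli of the frame series. With
  \<open>is_biframe_iff\<close> this places the frame operator in
  \<open>pos_bounded_below_operators\<close>.\<close>

lemma is_biframe_if_frame:
  assumes "is_frame f"
  shows "is_biframe f f"
proof -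
  obtain A B where AB: "A > 0" "B > 0" and f: "\<And>x. summable (\<lambda>k. (cmod (cinner x (f k)))\<^sup>2)"
      "\<And>x. A * (norm x)\<^sup>2 \<le> (\<Sum>k. (cmod (cinner x (f k)))\<^sup>2)"
      "\<And>x. (\<Sum>k. (cmod (cinner x (f k)))\<^sup>2) \<le> B * (norm x)\<^sup>2"
    using assms by (auto simp: is_frame_def)
  have "cinner x (f k) * cinner (f k) x = of_real ((cmod (cinner x (f k)))\<^sup>2)" for x k
    unfolding cinner_commute[of "f k"] by (rule complex_norm_square[symmetric])
  then have "(\<lambda>k. cinner x (f k) * cinner (f k) x) sums of_real (\<Sum>k. (cmod (cinner x (f k)))\<^sup>2)" for x
    using summable_sums[OF f(1)[of x]] by (simp only: sums_of_real_iff)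
  then show ?thesis
    unfolding is_biframe_def using AB f(2,3) by blast
qed

lemma is_frame_if_biframe:
  assumes f: "bessel_sequence f" and g: "bessel_sequence g" and fg: "is_biframe f g"
  shows "is_frame g"
proof -
  obtain B where B: "B > 0" "\<And>x. summable (\<lambda>k. (cmod (cinner x (f k)))\<^sup>2)"
      "\<And>x. (\<Sum>k. (cmod (cinner x (f k)))\<^sup>2) \<le> B * (norm x)\<^sup>2"
    using f by (auto simp: bessel_sequence_def)
  obtain C where C: "C > 0" "\<And>x. summable (\<lambda>k. (cmod (cinner x (g k)))\<^sup>2)"
      "\<And>x. (\<Sum>k. (cmod (cinner x (g k)))\<^sup>2) \<le> C * (norm x)\<^sup>2"
    using g by (auto simp: bessel_sequence_def)
  obtain A where A: "A > 0" "\<forall>x. \<exists>s::real.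
      (\<lambda>k. cinner x (f k) * cinner (g k) x) sums complex_of_real s \<and> A * (norm x)\<^sup>2 \<le> s"
    using fg unfolding is_biframe_def by blast
  \<comment> \<open>Cauchy--Schwarz on partial sums gives, in the limit, A^2 |x|^4 \<le> s^2 \<le> B
    |x|^2 ?G. Dividing by B |x|^2 produces the constant and requires x nonzero.\<close>
  have "A\<^sup>2 / B * (norm x)\<^sup>2 \<le> (\<Sum>k. (cmod (cinner x (g k)))\<^sup>2)" (is "_ \<le> ?G") for x
  proof (cases "x = 0")
    case True
    then show ?thesis using suminf_nonneg[OF C(2)[of x]] by simp
  next
    case False
    obtain s where s: "(\<lambda>k. cinner x (f k) * cinner (g k) x) sums complex_of_real s"
        "A * (norm x)\<^sup>2 \<le> s"
      using A(2) by blast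
    have "(norm (complex_of_real s))\<^sup>2 \<le> (B * (norm x)\<^sup>2) * ?G"
    proof (rule LIMSEQ_le_const2)
      show "(\<lambda>n. (norm (\<Sum>k<n. cinner x (f k) * cinner (g k) x))\<^sup>2)
          \<longlonglongrightarrow> (norm (complex_of_real s))\<^sup>2"
        using s(1) by (intro tendsto_power tendsto_norm) (simp add: sums_def)
      have "(norm (\<Sum>k<n. cinner x (f k) * cinner (g k) x))\<^sup>2 \<le> (B * (norm x)\<^sup>2) * ?G" for n
      proof -
        have "norm (\<Sum>k<n. cinner x (f k) * cinner (g k) x)
            \<le> (\<Sum>k<n. cmod (cinner x (f k)) * cmod (cinner x (g k)))"
          by (rule order_trans[OF norm_sum]) (simp add: norm_mult cmod_cinner_commute)
        then have "(norm (\<Sum>k<n. cinner x (f k) * cinner (g k) x))\<^sup>2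
            \<le> (\<Sum>k<n. cmod (cinner x (f k)) * cmod (cinner x (g k)))\<^sup>2"
          by (intro power_mono) auto
        also have "\<dots> \<le> (\<Sum>k<n. (cmod (cinner x (f k)))\<^sup>2) * (\<Sum>k<n. (cmod (cinner x (g k)))\<^sup>2)"
          by (rule Cauchy_Schwarz_ineq_sum)
        also have "\<dots> \<le> (B * (norm x)\<^sup>2) * ?G"
          using B(1) B(3)[of x] sum_le_suminf[OF B(2)[of x], of "{..<n}"]
            sum_le_suminf[OF C(2)[of x], of "{..<n}"]
          by (intro mult_mono) (auto intro: sum_nonneg)
        finally show ?thesis .
      qed
      then show "\<exists>N. \<forall>n\<ge>N. (norm (\<Sum>k<n. cinner x (f k) * cinner (g k) x))\<^sup>2
          \<le> (B * (norm x)\<^sup>2) * ?G"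
        by blast
    qed
    moreover have "(A * (norm x)\<^sup>2)\<^sup>2 \<le> s\<^sup>2"
      using A(1) s(2) by (intro power_mono) auto
    ultimately have "A\<^sup>2 * (norm x)\<^sup>2 * (norm x)\<^sup>2 \<le> B * ?G * (norm x)\<^sup>2"
      by (simp add: power2_eq_square mult_ac)
    then have "A\<^sup>2 * (norm x)\<^sup>2 \<le> B * ?G"
      using False by (simp add: mult_le_cancel_right)
    then show ?thesis
      using B(1) by (simp add: field_simps)
  qed
  moreover have "A\<^sup>2 / B > 0" using A B by simp
  ultimately show ?thesis
    unfolding is_frame_def using C by blast
qed

section \<open>Stability of Bessel sequences\<close>

lemma bessel_sequence_image:
  assumes f: "bessel_sequence f" and T': "bounded_linear T'"
    and adj: "\<And>x y. cinner (T' x) y = cinner x (T y)"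
  shows "bessel_sequence (\<lambda>k. T (f k))"
proof -
  obtain B where B: "B > 0" "\<And>x. summable (\<lambda>k. (cmod (cinner x (f k)))\<^sup>2)"
      "\<And>x. (\<Sum>k. (cmod (cinner x (f k)))\<^sup>2) \<le> B * (norm x)\<^sup>2"
    using f by (auto simp: bessel_sequence_def)
  interpret T': bounded_linear T' by fact
  obtain K where K: "K > 0" "\<And>x. norm (T' x) \<le> norm x * K" using T'.pos_bounded by blast
  \<comment> \<open>By \<open>adj\<close> the coefficients of x against \<open>T (f k)\<close> are
    those of \<open>T' x\<close> against \<open>f k\<close>, so the Bessel bound of \<open>f\<close>
    at \<open>T' x\<close> applies; the factor K^2 comes from the norm of \<open>T'\<close>.\<close>
  have "(\<Sum>k. (cmod (cinner (T' x) (f k)))\<^sup>2) \<le> (B * K\<^sup>2) * (norm x)\<^sup>2" for x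
  proof -
    have "(norm (T' x))\<^sup>2 \<le> (norm x * K)\<^sup>2" using K by (intro power_mono) auto
    then have "B * (norm (T' x))\<^sup>2 \<le> B * (norm x * K)\<^sup>2" using B(1) by simp
    then show ?thesis using B(3)[of "T' x"] by (simp add: power_mult_distrib mult_ac)
  qed
  then show ?thesis
    unfolding bessel_sequence_def adj[symmetric]
    using B K by (intro exI[of _ "B * K\<^sup>2"]) simp
qed

lemma bessel_sequence_add:
  assumes "bessel_sequence f" "bessel_sequence g"
  shows "bessel_sequence (\<lambda>k. f k + g k)"
proof -
  obtain B where B: "B > 0" "\<And>x. summable (\<lambda>k. (cmod (cinner x (f k)))\<^sup>2)"
      "\<And>x. (\<Sum>k. (cmod (cinner x (f k)))\<^sup>2) \<le> B * (norm x)\<^sup>2"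
    using assms(1) by (auto simp: bessel_sequence_def)
  obtain C where C: "C > 0" "\<And>x. summable (\<lambda>k. (cmod (cinner x (g k)))\<^sup>2)"
      "\<And>x. (\<Sum>k. (cmod (cinner x (g k)))\<^sup>2) \<le> C * (norm x)\<^sup>2"
    using assms(2) by (auto simp: bessel_sequence_def)
  have le: "(cmod (cinner x (f k + g k)))\<^sup>2
      \<le> 2 * (cmod (cinner x (f k)))\<^sup>2 + 2 * (cmod (cinner x (g k)))\<^sup>2" for x k
  proof -
    let ?a = "cmod (cinner x (f k))" and ?b = "cmod (cinner x (g k))"
    have "(cmod (cinner x (f k + g k)))\<^sup>2 \<le> (?a + ?b)\<^sup>2"
      by (intro power_mono) (auto simp: cinner_add_right norm_triangle_ineq)
    also have "\<dots> \<le> 2 * ?a\<^sup>2 + 2 * ?b\<^sup>2"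
      using zero_le_power2[of "?a - ?b"] by (simp add: power2_eq_square algebra_simps)
    finally show ?thesis .
  qed
  have sums: "(\<lambda>k. 2 * (cmod (cinner x (f k)))\<^sup>2 + 2 * (cmod (cinner x (g k)))\<^sup>2) sums
      (2 * (\<Sum>k. (cmod (cinner x (f k)))\<^sup>2) + 2 * (\<Sum>k. (cmod (cinner x (g k)))\<^sup>2))" for x
    by (intro sums_add sums_mult summable_sums B C)
  have summable: "summable (\<lambda>k. (cmod (cinner x (f k + g k)))\<^sup>2)" for x
    by (rule summable_comparison_test'[OF sums_summable[OF sums[of x]], of 0]) (use le in simp)
  have "(\<Sum>k. (cmod (cinner x (f k + g k)))\<^sup>2) \<le> (2 * B + 2 * C) * (norm x)\<^sup>2" for x
  proof -
    have "(\<Sum>k. (cmod (cinner x (f k + g k)))\<^sup>2)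
        \<le> 2 * (\<Sum>k. (cmod (cinner x (f k)))\<^sup>2) + 2 * (\<Sum>k. (cmod (cinner x (g k)))\<^sup>2)"
      using sums_le[OF le summable_sums[OF summable] sums] .
    then show ?thesis using B(3)[of x] C(3)[of x] by (simp add: algebra_simps)
  qed
  with summable show ?thesis
    unfolding bessel_sequence_def using B(1) C(1) by (intro exI[of _ "2 * B + 2 * C"]) simp
qed

lemma bessel_sequence_uminus: "bessel_sequence f \<Longrightarrow> bessel_sequence (\<lambda>k. - f k)"
  unfolding bessel_sequence_def
  by (simp add: bounded_bilinear.minus_right[OF bounded_bilinear_cinner])

section \<open>The parametrization\<close>

theorem theorem5p3:
  fixes f g :: "nat \<Rightarrow> 'a::chilbert_space"
  assumes separable: "\<exists>D::'a set. countable D \<and> closure D = UNIV"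
    and frame: "is_frame f"
  shows
    "(bessel_sequence g \<and> is_biframe f g \<longleftrightarrow>
      (\<exists>Q\<in>pos_bounded_below_operators. \<exists>h. bessel_sequence h \<and>
        (\<forall>k. g k = inv (frame_operator f \<circ> Q) (f k) + h k
                   - (\<Sum>j. cinner (inv (frame_operator f) (f k)) (f j) *\<^sub>C h j))))
     \<and>
     ((\<exists>Q\<in>pos_bounded_below_operators. \<exists>h. bessel_sequence h \<and>
        (\<forall>k. g k = inv (frame_operator f \<circ> Q) (f k) + h k
                   - (\<Sum>j. cinner (inv (frame_operator f) (f k)) (f j) *\<^sub>C h j))) \<longleftrightarrow>
      is_frame g \<and> is_biframe f g)"
    (is "(?i \<longleftrightarrow> ?ii) \<and> (?ii \<longleftrightarrow> ?iii)")
proof -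
  let ?S = "frame_operator f"
  have f: "bessel_sequence f" using frame by (rule bessel_sequence_if_frame)
  have S: "?S \<in> pos_bounded_below_operators"
    using is_biframe_iff[OF f f] is_biframe_if_frame[OF frame] by (simp add: frame_operator_eq_mixed)
  note bijS = bij_if_pos_bounded_below[OF S]
  have SiS: "inv ?S (?S x) = x" for x using bijS by (simp add: bij_is_inj)
  \<comment> \<open>Splits the inverse of the product in (ii) into \<open>inv Q\<close> after
    \<open>inv ?S\<close>; both factors are bijective.\<close>
  have inv_comp: "inv (?S \<circ> Q) x = inv Q (inv ?S x)"
    if "Q \<in> pos_bounded_below_operators" for Q x
    using o_inv_distrib[OF bijS bij_if_pos_bounded_below[OF that]] by simp
  have "?ii" if g: "bessel_sequence g" and fg: "is_biframe f g"
  proof -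
    let ?T = "mixed_frame_operator f g"
    have T: "?T \<in> pos_bounded_below_operators"
      using is_biframe_iff[OF f g] fg by simp
    have iT: "inv ?T \<in> pos_bounded_below_operators" using T by (rule inv_pos_bounded_below)
    have "inv (inv ?T) = ?T" using T by (intro inv_inv_eq bij_if_pos_bounded_below)
    \<comment> \<open>With \<open>Q = inv ?T\<close> the first term of (ii) is
      \<open>?T (inv ?S (f k))\<close>. For \<open>h = g\<close> this is exactly the subtracted
      series, so only \<open>g k\<close> remains.\<close>
    then show ?thesis
      using g by (intro bexI[OF _ iT] exI[of _ g])
        (simp add: inv_comp[OF iT] mixed_frame_operator_def)
  qed
  moreover have "bessel_sequence g \<and> is_biframe f g" if ii: ?ii
  proof -
    obtain Q h where Q: "Q \<in> pos_bounded_below_operators" and h: "bessel_sequence h"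
      and "\<forall>k. g k = inv (?S \<circ> Q) (f k) + h k - (\<Sum>j. cinner (inv ?S (f k)) (f j) *\<^sub>C h j)"
      using ii by blast
    \<comment> \<open>The series in (ii) is the mixed operator of \<open>f\<close> and
      \<open>h\<close> at \<open>inv ?S (f k)\<close>. Thus \<open>g\<close> is a sum of
      \<open>h\<close> and operator images of the canonical dual \<open>inv ?S (f k)\<close>, which
      makes it Bessel.\<close>
    then have g: "g k = inv Q (inv ?S (f k)) + h k + - mixed_frame_operator f h (inv ?S (f k))" for k
      by (simp add: inv_comp mixed_frame_operator_def)
    have iQ: "inv Q \<in> pos_bounded_below_operators" and iS: "inv ?S \<in> pos_bounded_below_operators"
      using Q S by (auto intro: inv_pos_bounded_below)
    note iQ' = iQ[unfolded pos_bounded_below_operators_def bounded_clinear_def self_adjoint_def]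
      and iS' = iS[unfolded pos_bounded_below_operators_def bounded_clinear_def self_adjoint_def]
    interpret iQ: bounded_linear "inv Q" using iQ' by simp
    interpret iS: bounded_linear "inv ?S" using iS' by simp
    have C: "bounded_clinear (mixed_frame_operator f h)"
      using f h by (rule bounded_clinear_mixed_frame_operator)
    interpret C: bounded_linear "mixed_frame_operator f h"
      using C by (simp add: bounded_clinear_def)
    \<comment> \<open>The self-adjoint inverses serve as their own adjoints in
      \<open>bessel_sequence_image\<close>; for the mixed operator below, the adjoint swaps
      \<open>f\<close> and \<open>h\<close>.\<close>
    have iSf: "bessel_sequence (\<lambda>k. inv ?S (f k))"
      by (rule bessel_sequence_image[OF f iS.bounded_linear_axioms]) (use iS' in simp)
    have "bessel_sequence (\<lambda>k. inv Q (inv ?S (f k)))"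
      by (rule bessel_sequence_image[OF iSf iQ.bounded_linear_axioms]) (use iQ' in simp)
    moreover have "bessel_sequence (\<lambda>k. mixed_frame_operator f h (inv ?S (f k)))"
    proof (rule bessel_sequence_image[OF iSf])
      show "bounded_linear (mixed_frame_operator h f)"
        using bounded_clinear_mixed_frame_operator[OF h f] by (simp add: bounded_clinear_def)
    qed (rule mixed_frame_operator_adjoint[OF h f])
    ultimately have "bessel_sequence
        (\<lambda>k. inv Q (inv ?S (f k)) + h k + - mixed_frame_operator f h (inv ?S (f k)))"
      using h by (intro bessel_sequence_add bessel_sequence_uminus)
    then have bg: "bessel_sequence g" by (simp add: g[abs_def])
    have "mixed_frame_operator f g x = inv Q x" for x
    proof -
      have "(\<lambda>k. cinner x (f k) *\<^sub>C f k) sums ?S x"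
        unfolding frame_operator_eq_mixed by (rule mixed_frame_operator_sums[OF f f])
      \<comment> \<open>The reconstruction formula: applying \<open>inv ?S\<close> termwise to the
        series of \<open>?S x\<close> expands x in the canonical dual.\<close>
      from iS.sums[OF this] have *: "(\<lambda>k. cinner x (f k) *\<^sub>C inv ?S (f k)) sums x"
        using iS' by (simp add: SiS)
      \<comment> \<open>Applying \<open>inv Q\<close> and the mixed operator of \<open>f\<close> and
        \<open>h\<close> to the reconstruction formula sums the first and third parts. The third has
        the same sum as the series of \<open>h\<close>, so the two cancel and leave
        \<open>inv Q x\<close>.\<close>
      have "(\<lambda>k. cinner x (f k) *\<^sub>C inv Q (inv ?S (f k)) + cinner x (f k) *\<^sub>C h k
          - cinner x (f k) *\<^sub>C mixed_frame_operator f h (inv ?S (f k)))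
          sums (inv Q x + mixed_frame_operator f h x - mixed_frame_operator f h x)"
        using iQ.sums[OF *] C.sums[OF *] iQ' C
        by (intro sums_add sums_diff mixed_frame_operator_sums[OF f h]) (simp_all add: bounded_clinear_def)
      then have "(\<lambda>k. cinner x (f k) *\<^sub>C g k) sums inv Q x"
        by (simp add: g scaleC_add_right linear_diff[OF bounded_linear.linear[OF bounded_linear_scaleC]])
      with mixed_frame_operator_sums[OF f bg] show ?thesis by (rule sums_unique2)
    qed
    then have "mixed_frame_operator f g = inv Q" by (simp add: fun_eq_iff)
    with iQ bg show ?thesis using is_biframe_iff[OF f bg] by simp
  qed
  \<comment> \<open>It remains to link (i) and (iii): the biframe property makes a Bessel sequence
    \<open>g\<close> a frame, and every frame is Bessel.\<close>
  ultimately show ?thesis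
    using is_frame_if_biframe[OF f] bessel_sequence_if_frame[of g] by blast
qed

end
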